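(* The BCS state $\Psi_{BCS}$ has a lower energy than the Fermi vacuum $\Psi_F$ (the normal state), i.e., $$(\Psi_{BCS},H\Psi_{BCS})-(\Psi_F,H\Psi_F)=-\frac12\sum_{k\in\Lambda}\frac{\left(\sqrt{\xi_k^2+\Delta_k^2}-|\xi_k|\right)^2}{\sqrt{\xi_k^2+\Delta_k^2}}<0.$$
   Context: Fix (large) real numbers $L,K_{max}>0$ and let $\Lambda=\{\frac{2\pi}{L}(n_1,n_2,n_3)\in\mathbb{R}^3: n_1,n_2,n_3\in\mathbb{Z},\ \frac{2\pi}{L}\sqrt{n_1^2+n_2^2+n_3^2}\le K_{max}\}$, a finite set with $M$ elements, whose elements are arranged in a fixed order. Let $\mathcal{H}=\mathbb{C}^{2^{2M}}$ with its standard inner product $(\cdot,\cdot)$; its standard unit vectors are labelled $|n_{k\uparrow},n_{k\downarrow},n_{k'\uparrow},n_{k'\downarrow},\ldots\rangle$ with $n_{k\sigma}\in\{0,1\}$, $k\in\Lambda$, $\sigma\in\{\uparrow,\downarrow\}$, and $|0\rangle$ denotes the one with all $n_{k\sigma}=0$. The annihilation operator $C_{k\sigma}$ is the linear operator on $\mathcal{H}$ which sends a standard unit vector with $n_{k\sigma}=1$ to $(-1)^{s}$ times the standard unit vector obtained by replacing $n_{k\sigma}$ by $0$, where $s$ is the sum of the occupation numbers to the left of $n_{k\sigma}$, and sends a standard unit vector with $n_{k\sigma}=0$ to $0$. The creation operator $C_{k\sigma}^*$ sends a standard unit vector with $n_{k\sigma}=0$ to $(-1)^{s}$ times the one with $n_{k\sigma}$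 replaced by $1$ (same $s$), and one with $n_{k\sigma}=1$ to $0$; it is the adjoint of $C_{k\sigma}$. Let $m,\mu>0$ be the electron mass and the chemical potential, and $\xi_k=\hbar^2|k|^2/(2m)-\mu$. Let $U_{k,k'}$ be a function of $k,k'\in\Lambda$ with $U_{k,k'}\le 0$, $U_{k',k}=U_{k,k'}$, $U_{-k,-k'}=U_{k,k'}$, $U_{k,k}=0$. The BCS Hamiltonian is $$H=\sum_{k\in\Lambda,\,\sigma=\uparrow,\downarrow}\xi_kC_{k\sigma}^*C_{k\sigma}+\sum_{k,k'\in\Lambda}U_{k,k'}C_{k'\uparrow}^*C_{-k'\downarrow}^*C_{-k\downarrow}C_{k\uparrow}.$$ It is assumed that there is a function $\Delta_k\ge0$ of $k\in\Lambda$ with $\Delta_{-k}=\Delta_k$ solving the gap equation $\Delta_k=-\frac12\sum_{k'\in\Lambda}U_{k,k'}\Delta_{k'}/\sqrt{\xi_{k'}^2+\Delta_{k'}^2}$; fix such a $\Delta$. Let $\theta_k\in[0,\pi/2]$ satisfy $\sin2\theta_k=\Delta_k/\sqrt{\xi_k^2+\Delta_k^2}$, $\cos2\theta_k=\xi_k/\sqrt{\xi_k^2+\Delta_k^2}$ (when $\Delta_k=0$ for all $k\in\Lambda$, it is assumed that $\theta_k=\pi/2$ for those $k$ with $\xi_k=0$). Let $G_B=i\sum_{k\in\Lambda}\theta_k(C_{-k\downarrow}C_{k\uparrow}-C_{k\uparrow}^*C_{-k\downarrow}^* )$. The BCS state is $\Psi_{BCS}=e^{iG_B}|0\rangle$.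 The Fermi vacuum is $\Psi_F=\{\prod_{k\in\Lambda,\ \xi_k\le0}C_{k\uparrow}^*C_{-k\downarrow}^*\}|0\rangle$.
   Formalization: The strict inequality "< 0" is asserted only when Δ_k is not zero for all k in Λ, since for Δ ≡ 0 (which the setting admits) both energies are equal; the energy formula is proved also for Δ ≡ 0, with 0/0 terms (ξ_k = 0) read as 0. *)

theory Defs
  imports "HOL-Analysis.Analysis"
begin

definition momenta :: "real \<Rightarrow> real \<Rightarrow> (real^3) set" where
  "momenta L Kmax =
     {(2 * pi / L) *\<^sub>R vector [of_int n1, of_int n2, of_int n3] | n1 n2 n3 :: int.
        2 * pi / L * sqrt (of_int n1 ^ 2 + of_int n2 ^ 2 + of_int n3 ^ 2) \<le> Kmax}"

datatype spin = Up | Down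

type_synonym mode = "(real^3) \<times> spin"

text \<open>The fixed arrangement of the momenta is a list \<open>ks\<close> without repetitions; it induces the
  order of the labels \<open>|n\<^bsub>k\<up>\<^esub>, n\<^bsub>k\<down>\<^esub>, n\<^bsub>k'\<up>\<^esub>, n\<^bsub>k'\<down>\<^esub>, ...\<rangle>\<close>.\<close>

definition modes :: "(real^3) list \<Rightarrow> mode list" where
  "modes ks = concat (map (\<lambda>k. [(k, Up), (k, Down)]) ks)"

type_synonym occupation = "mode \<Rightarrow> nat"

text \<open>The labels of the standard unit vectors; the value 0 off the modes makes the label of a
  unit vector unique, so that there are \<open>2 ^ (2 * length ks)\<close> of them.\<close>

definition occupations :: "(real^3) list \<Rightarrow> occupation set" where
  "occupations ks =
     {n. (\<forall>j\<in>set (modes ks). n j \<in> {0, 1}) \<and> (\<forall>j. j \<notin> set (modes ks) \<longrightarrow> n j = 0)}"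

text \<open>A vector of the state space is the family of its coordinates with respect to the standard
  unit vectors. Coordinates outside \<open>occupations ks\<close> carry no meaning: the inner product and
  all operators ignore them.\<close>

type_synonym state = "occupation \<Rightarrow> complex"

definition ket :: "occupation \<Rightarrow> state" where
  "ket n = (\<lambda>n'. if n' = n then 1 else 0)"

definition vacuum :: state where
  "vacuum = ket (\<lambda>_. 0)"

definition braket :: "(real^3) list \<Rightarrow> state \<Rightarrow> state \<Rightarrow> complex" where
  "braket ks \<phi> \<psi> = (\<Sum>n\<in>occupations ks. cnj (\<phi> n) * \<psi> n)"

text \<open>The linear operator that sends each standard unit vector \<open>ket n\<close> to \<open>f n\<close>.\<close>

definition linear_ext :: "(real^3) list \<Rightarrow> (occupation \<Rightarrow> state) \<Rightarrow> state \<Rightarrow> state" where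
  "linear_ext ks f \<psi> = (\<lambda>n'. \<Sum>n\<in>occupations ks. \<psi> n * f n n')"

definition left_sum :: "(real^3) list \<Rightarrow> mode \<Rightarrow> occupation \<Rightarrow> nat" where
  "left_sum ks j n = (\<Sum>i\<leftarrow>takeWhile (\<lambda>i. i \<noteq> j) (modes ks). n i)"

definition annih :: "(real^3) list \<Rightarrow> mode \<Rightarrow> state \<Rightarrow> state" where
  "annih ks j = linear_ext ks (\<lambda>n n'.
     if n j = 1 then (-1) ^ left_sum ks j n * ket (n(j := 0)) n' else 0)"

definition creat :: "(real^3) list \<Rightarrow> mode \<Rightarrow> state \<Rightarrow> state" where
  "creat ks j = linear_ext ks (\<lambda>n n'.
     if n j = 0 then (-1) ^ left_sum ks j n * ket (n(j := 1)) n' else 0)"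

definition BCS_Hamiltonian ::
  "(real^3) list \<Rightarrow> (real^3 \<Rightarrow> real) \<Rightarrow> (real^3 \<Rightarrow> real^3 \<Rightarrow> real) \<Rightarrow> state \<Rightarrow> state" where
  "BCS_Hamiltonian ks \<xi> U \<psi> = (\<lambda>n.
     (\<Sum>k\<in>set ks. \<Sum>\<sigma>\<in>{Up, Down}.
        of_real (\<xi> k) * creat ks (k, \<sigma>) (annih ks (k, \<sigma>) \<psi>) n) +
     (\<Sum>k\<in>set ks. \<Sum>k'\<in>set ks. of_real (U k k') *
        creat ks (k', Up) (creat ks (- k', Down)
          (annih ks (- k, Down) (annih ks (k, Up) \<psi>))) n))"

definition Bogoliubov_generator ::
  "(real^3) list \<Rightarrow> (real^3 \<Rightarrow> real) \<Rightarrow> state \<Rightarrow> state" where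
  "Bogoliubov_generator ks \<theta> \<psi> = (\<lambda>n. \<i> *
     (\<Sum>k\<in>set ks. of_real (\<theta> k) *
        (annih ks (- k, Down) (annih ks (k, Up) \<psi>) n -
         creat ks (k, Up) (creat ks (- k, Down) \<psi>) n)))"

text \<open>The exponential series of an operator. The space is finite-dimensional, so convergence
  in norm and convergence of each coordinate agree.\<close>

definition op_exp :: "(state \<Rightarrow> state) \<Rightarrow> state \<Rightarrow> state" where
  "op_exp A \<psi> = (\<lambda>n. \<Sum>r. (A ^^ r) \<psi> n / fact r)"

definition BCS_state :: "(real^3) list \<Rightarrow> (real^3 \<Rightarrow> real) \<Rightarrow> state" where
  "BCS_state ks \<theta> =
     op_exp (\<lambda>\<psi> n. \<i> * Bogoliubov_generator ks \<theta> \<psi> n) vacuum"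

text \<open>The factors of the product commute; here they are taken in the order of \<open>ks\<close>.\<close>

definition Fermi_vacuum :: "(real^3) list \<Rightarrow> (real^3 \<Rightarrow> real) \<Rightarrow> state" where
  "Fermi_vacuum ks \<xi> =
     foldr (\<lambda>k \<psi>. creat ks (k, Up) (creat ks (- k, Down) \<psi>))
       (filter (\<lambda>k. \<xi> k \<le> 0) ks) vacuum"

end

theory Submission
  imports Defs
begin

text \<open>Relative to the basis vectors \<open>\<Prod>\<^bsub>k\<in>S\<^esub> C\<^sup>*\<^bsub>k\<up>\<^esub>C\<^sup>*\<^bsub>-k\<down>\<^esub>|0\<rangle>\<close> indexed by sets \<open>S\<close> of momenta, the pair operators
  add and remove elements of \<open>S\<close> without signs. There the vacuum is an average of \<open>2 ^ M\<close> product
  vectors that are eigenvectors of the Bogoliubov generator, so its exponential series reduces to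
  scalar ones and the BCS state has amplitudes \<open>\<Prod>\<^bsub>k\<in>S\<^esub> sin \<theta>\<^bsub>k\<^esub> \<Prod>\<^bsub>k\<notin>S\<^esub> cos \<theta>\<^bsub>k\<^esub>\<close>. The Fermi vacuum is a product
  state too, with 0/1 factors. Product states have an explicit energy, which the gap equation
  turns into the claimed difference.\<close>

section \<open>Order of the modes and fermionic sign exponents\<close>

lemma takeWhile_neq_total:
  assumes "i \<in> set xs" "j \<in> set xs" "i \<noteq> j"
  shows "i \<in> set (takeWhile (\<lambda>x. x \<noteq> j) xs) \<longleftrightarrow> j \<notin> set (takeWhile (\<lambda>x. x \<noteq> i) xs)"
  using assms by (induction xs) auto

text \<open>The strict order of the modes in their arrangement. It turns the sign exponent of a
  ladder operator into a sum over a set, where contributions of single pairs can be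
  separated.\<close>

definition before :: "(real^3) list \<Rightarrow> mode \<Rightarrow> mode \<Rightarrow> bool" where
  "before ks i j \<longleftrightarrow> i \<in> set (takeWhile (\<lambda>i. i \<noteq> j) (modes ks))"

lemma set_modes: "set (modes ks) = set ks \<times> UNIV"
proof -
  have "(UNIV :: spin set) = {Up, Down}" using spin.exhaust by blast
  then show ?thesis by (auto simp: modes_def)
qed

lemma distinct_modes: "distinct ks \<Longrightarrow> distinct (modes ks)"
  by (induction ks) (auto simp: modes_def)

lemma not_before_self: "\<not> before ks j j"
  unfolding before_def using set_takeWhileD by fastforce

lemma finite_before: "finite {i. before ks i j}"
  unfolding before_def by simp

lemma left_sum_eq:
  assumes "distinct ks"
  shows "left_sum ks j n = (\<Sum>i | before ks i j. n i)"
  unfolding left_sum_def before_def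
  by (simp add: sum.distinct_set_conv_list[OF distinct_takeWhile[OF distinct_modes[OF assms]]])

text \<open>No mode stands to the left of itself. Hence creating and annihilating the same mode
  carry the same sign.\<close>

lemma left_sum_upd_self:
  "distinct ks \<Longrightarrow> left_sum ks j (n(j := x)) = left_sum ks j n"
  by (auto simp: left_sum_eq not_before_self intro!: sum.cong)

lemma left_sum_upd_one:
  assumes "distinct ks" "n i = 0"
  shows "left_sum ks j (n(i := 1)) = left_sum ks j n + of_bool (before ks i j)"
proof -
  have "(\<Sum>i' | before ks i' j. (n(i := 1)) i')
      = (\<Sum>i' | before ks i' j. n i' + (if i' = i then 1 else 0))"
    using assms by (intro sum.cong) auto
  also have "\<dots> = (\<Sum>i' | before ks i' j. n i') + of_bool (before ks i j)"
    using finite_before[of ks j] by (simp add: sum.distrib)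
  finally show ?thesis using assms by (simp add: left_sum_eq)
qed

section \<open>Ladder operators on standard unit vectors\<close>

lemma finite_occupations: "finite (occupations ks)"
proof -
  have "occupations ks \<subseteq> {n. \<forall>j. (j \<in> set (modes ks) \<longrightarrow> n j \<in> {0, 1}) \<and>
      (j \<notin> set (modes ks) \<longrightarrow> n j = 0)}"
    by (auto simp: occupations_def)
  then show ?thesis
    using finite_set_of_finite_funs[of "set (modes ks)" "{0, 1::nat}" 0] finite_subset by blast
qed

lemma linear_ext_sum:
  "linear_ext ks F (\<lambda>n. \<Sum>x\<in>X. c x * \<psi> x n) = (\<lambda>n. \<Sum>x\<in>X. c x * linear_ext ks F (\<psi> x) n)"
  unfolding linear_ext_def
  by (simp add: sum_distrib_left sum_distrib_right mult.assoc) (subst sum.swap, rule refl)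

lemma linear_ext_scale:
  "linear_ext ks F (\<lambda>n. c * \<psi> n) = (\<lambda>n. c * linear_ext ks F \<psi> n)"
  unfolding linear_ext_def by (simp add: sum_distrib_left mult.assoc)

lemma linear_ext_zero: "linear_ext ks F (\<lambda>n. 0) = (\<lambda>n. 0)"
  unfolding linear_ext_def by simp

lemma linear_ext_ket:
  assumes "n \<in> occupations ks"
  shows "linear_ext ks F (ket n) = F n"
proof
  fix n'
  have "linear_ext ks F (ket n) n' = (\<Sum>m\<in>occupations ks. if m = n then F m n' else 0)"
    unfolding linear_ext_def ket_def by (intro sum.cong) auto
  then show "linear_ext ks F (ket n) n' = F n n'"
    using assms finite_occupations by simp
qed

lemma creat_ket:
  assumes "n \<in> occupations ks"
  shows "creat ks j (ket n) =
    (if n j = 0 then (\<lambda>n'. (-1) ^ left_sum ks j n * ket (n(j := 1)) n') else (\<lambda>n'. 0))"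
  unfolding creat_def linear_ext_ket[OF assms] by auto

lemma annih_ket:
  assumes "n \<in> occupations ks"
  shows "annih ks j (ket n) =
    (if n j = 1 then (\<lambda>n'. (-1) ^ left_sum ks j n * ket (n(j := 0)) n') else (\<lambda>n'. 0))"
  unfolding annih_def linear_ext_ket[OF assms] by auto

lemma creat_linear:
  "creat ks j (\<lambda>n. \<Sum>x\<in>X. c x * \<psi> x n) = (\<lambda>n. \<Sum>x\<in>X. c x * creat ks j (\<psi> x) n)"
  "creat ks j (\<lambda>n. a * \<phi> n) = (\<lambda>n. a * creat ks j \<phi> n)"
  "creat ks j (\<lambda>n. 0) = (\<lambda>n. 0)"
  unfolding creat_def by (rule linear_ext_sum linear_ext_scale linear_ext_zero)+

lemma annih_linear:
  "annih ks j (\<lambda>n. \<Sum>x\<in>X. c x * \<psi> x n) = (\<lambda>n. \<Sum>x\<in>X. c x * annih ks j (\<psi> x) n)"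
  "annih ks j (\<lambda>n. a * \<phi> n) = (\<lambda>n. a * annih ks j \<phi> n)"
  "annih ks j (\<lambda>n. 0) = (\<lambda>n. 0)"
  unfolding annih_def by (rule linear_ext_sum linear_ext_scale linear_ext_zero)+

lemma occupations_upd:
  "\<lbrakk>n \<in> occupations ks; j \<in> set (modes ks); x \<in> {0, 1}\<rbrakk> \<Longrightarrow> n(j := x) \<in> occupations ks"
  by (auto simp: occupations_def)

section \<open>Labels and signs of pair states\<close>

definition pair_occ :: "(real^3) set \<Rightarrow> occupation" where
  "pair_occ S = (\<lambda>(k, \<sigma>). of_bool (case \<sigma> of Up \<Rightarrow> k \<in> S | Down \<Rightarrow> - k \<in> S))"

lemma pair_occ_simps [simp]:
  "pair_occ S (k, Up) = of_bool (k \<in> S)" "pair_occ S (k, Down) = of_bool (- k \<in> S)"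
  by (auto simp: pair_occ_def)

lemma pair_occ_inject: "pair_occ S = pair_occ T \<longleftrightarrow> S = T"
proof
  assume eq: "pair_occ S = pair_occ T"
  have "k \<in> S \<longleftrightarrow> k \<in> T" for k
    using fun_cong[OF eq, of "(k, Up)"] by (simp add: of_bool_def split: if_splits)
  then show "S = T" by blast
qed simp

lemma pair_occ_insert:
  "pair_occ (insert k S) = (pair_occ S)((- k, Down) := 1, (k, Up) := 1)"
proof (intro ext)
  fix j :: mode
  obtain q \<sigma> where j: "j = (q, \<sigma>)" by fastforce
  show "pair_occ (insert k S) j = ((pair_occ S)((- k, Down) := 1, (k, Up) := 1)) j"
    unfolding j by (cases \<sigma>; cases "q = - k") auto
qed

text \<open>Pair \<open>q\<close> owns the modes \<open>(q, Up)\<close> and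
  \<open>(- q, Down)\<close>, and different pairs own disjoint modes. So the label is a sum of
  indicators, and the sign exponents become sums over the occupied pairs.\<close>

lemma pair_occ_sum:
  assumes "finite S"
  shows "pair_occ S i = (\<Sum>q\<in>S. of_bool (i = (q, Up)) + of_bool (i = (- q, Down)))"
proof -
  obtain k \<sigma> where i: "i = (k, \<sigma>)" by fastforce
  have "(\<Sum>q\<in>S. of_bool (i = (q, Up)) + of_bool (i = (- q, Down)))
      = (\<Sum>q\<in>S. of_bool (q = (case \<sigma> of Up \<Rightarrow> k | Down \<Rightarrow> - k)) :: nat)"
    unfolding i by (intro sum.cong refl) (cases \<sigma>; auto)
  then show ?thesis
    using assms unfolding i by (cases \<sigma>) (simp_all add: of_bool_def)
qed

text \<open>Chosen so that, for \<open>q \<noteq> p\<close>, \<open>pair_crossings ks q p + pair_crossings ks p q\<close> has the parity of the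
  number of ways to choose a mode of the pair \<open>q\<close> to the left of a mode of the pair \<open>p\<close>, which is
  the sign that the pair \<open>q\<close> contributes when the pair \<open>p\<close> is created.\<close>

definition pair_crossings :: "(real^3) list \<Rightarrow> real^3 \<Rightarrow> real^3 \<Rightarrow> nat" where
  "pair_crossings ks q p = of_bool (before ks (- q, Down) (p, Up)) +
     of_bool (before ks (q, Up) (p, Up) \<and> before ks (- q, Down) (- p, Down))"

text \<open>The sign between a standard unit vector and the corresponding product of pair creation
  operators applied to the vacuum. Its exponent is a double sum over \<open>S\<close>, so that
  inserting one momentum changes it by an expression linear in \<open>S\<close>, as the ladder
  operators do.\<close>

definition pair_sign :: "(real^3) list \<Rightarrow> (real^3) set \<Rightarrow> complex" where
  "pair_sign ks S = (-1) ^ (\<Sum>q\<in>S. \<Sum>p\<in>S. pair_crossings ks q p)"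

lemma pair_sign_simps [simp]:
  "pair_sign ks {} = 1" "pair_sign ks S * pair_sign ks S = 1" "cnj (pair_sign ks S) = pair_sign ks S"
  by (auto simp: pair_sign_def simp flip: power_mult_distrib)

definition create_pair :: "(real^3) list \<Rightarrow> real^3 \<Rightarrow> state \<Rightarrow> state" where
  "create_pair ks k \<psi> = creat ks (k, Up) (creat ks (- k, Down) \<psi>)"

definition annih_pair :: "(real^3) list \<Rightarrow> real^3 \<Rightarrow> state \<Rightarrow> state" where
  "annih_pair ks k \<psi> = annih ks (- k, Down) (annih ks (k, Up) \<psi>)"

definition pair_ket :: "(real^3) list \<Rightarrow> (real^3) set \<Rightarrow> state" where
  "pair_ket ks S = (\<lambda>n. pair_sign ks S * ket (pair_occ S) n)"

definition pair_vec :: "(real^3) list \<Rightarrow> ((real^3) set \<Rightarrow> complex) \<Rightarrow> state" where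
  "pair_vec ks f = (\<lambda>n. \<Sum>S\<in>Pow (set ks). f S * pair_ket ks S n)"

section \<open>Pair operators acting on signed pair states\<close>

locale momentum_list =
  fixes ks :: "(real^3) list"
  assumes distinct_ks: "distinct ks"
    and uminus_ks: "k \<in> set ks \<Longrightarrow> - k \<in> set ks"
begin

lemma mode_mem: "k \<in> set ks \<Longrightarrow> (k, \<sigma>) \<in> set (modes ks)"
  by (simp add: set_modes)

lemma before_total:
  "\<lbrakk>i \<in> set (modes ks); j \<in> set (modes ks); i \<noteq> j\<rbrakk> \<Longrightarrow> before ks i j \<longleftrightarrow> \<not> before ks j i"
  unfolding before_def by (rule takeWhile_neq_total)

lemma finite_subset_ks: "S \<subseteq> set ks \<Longrightarrow> finite S"
  using finite_subset by blast

text \<open>Closure of the momenta under negation places the partner \<open>(- k, Down)\<close> of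
  \<open>(k, Up)\<close> among the modes.\<close>

lemma pair_occ_occupations:
  assumes "S \<subseteq> set ks"
  shows "pair_occ S \<in> occupations ks"
proof -
  have "pair_occ S (k, \<sigma>) \<in> {0, 1} \<and> ((k, \<sigma>) \<notin> set (modes ks) \<longrightarrow> pair_occ S (k, \<sigma>) = 0)" for k \<sigma>
    using assms uminus_ks[of "- k"] by (cases \<sigma>) (auto simp: set_modes)
  then show ?thesis unfolding occupations_def by (auto simp: split_paired_all)
qed

lemma left_sum_pair_occ:
  assumes "S \<subseteq> set ks"
  shows "left_sum ks j (pair_occ S) =
    (\<Sum>q\<in>S. of_bool (before ks (q, Up) j) + of_bool (before ks (- q, Down) j))"
proof -
  note fin = finite_subset_ks[OF assms]
  have "left_sum ks j (pair_occ S) =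
      (\<Sum>i | before ks i j. \<Sum>q\<in>S. of_bool (i = (q, Up)) + of_bool (i = (- q, Down)))"
    by (simp add: left_sum_eq[OF distinct_ks] pair_occ_sum[OF fin])
  also have "\<dots> = (\<Sum>q\<in>S. \<Sum>i | before ks i j. of_bool (i = (q, Up)) + of_bool (i = (- q, Down)))"
    by (rule sum.swap)
  also have "\<dots> = (\<Sum>q\<in>S. of_bool (before ks (q, Up) j) + of_bool (before ks (- q, Down) j))"
    using finite_before[of ks j]
    by (intro sum.cong) (auto simp: sum.distrib of_bool_def)
  finally show ?thesis .
qed

text \<open>The left side is the sign of creating the pair \<open>k\<close> on top of
  \<open>S\<close>: the left sums of its two modes, plus one if the Down mode, which is filled
  first, lies to the left of the Up mode. Modulo 2 this is the increment of the double sum in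
  \<open>pair_sign\<close>.\<close>

lemma pair_sign_insert:
  assumes S: "S \<subseteq> set ks" and k: "k \<in> set ks" "k \<notin> S"
  shows "(-1) ^ (left_sum ks (- k, Down) (pair_occ S) + left_sum ks (k, Up) (pair_occ S)
           + of_bool (before ks (- k, Down) (k, Up))) = pair_sign ks S * pair_sign ks (insert k S)"
proof -
  note fin = finite_subset_ks[OF S]
  let ?g = "pair_crossings ks"
  let ?Q = "\<lambda>S. \<Sum>q\<in>S. \<Sum>p\<in>S. ?g q p"
  define e where "e = left_sum ks (- k, Down) (pair_occ S) + left_sum ks (k, Up) (pair_occ S)
           + of_bool (before ks (- k, Down) (k, Up))"
  define c where "c q = of_bool (before ks (q, Up) (k, Up)) + of_bool (before ks (- q, Down) (k, Up))
     + of_bool (before ks (q, Up) (- k, Down)) + (of_bool (before ks (- q, Down) (- k, Down)) :: nat)" for q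
  have "?g k k = of_bool (before ks (- k, Down) (k, Up))"
    by (simp add: pair_crossings_def not_before_self)
  then have e: "e = (\<Sum>q\<in>S. c q) + ?g k k"
    unfolding e_def c_def by (simp add: left_sum_pair_occ[OF S] sum.distrib)
  have Q: "?Q (insert k S) = ?Q S + ?g k k + (\<Sum>q\<in>S. ?g k q + ?g q k)"
    using fin k by (simp add: sum.distrib)
  \<comment> \<open>Let \<open>a\<close> and \<open>b\<close> be the Up-Up and Down-Down comparisons
    of \<open>q\<close> with \<open>k\<close>. By totality of the order, the two conjunctions are
    \<open>a\<close> and \<open>b\<close>, and their joint negations, whose sum has the parity of
    \<open>1 + a + b\<close>. The mixed comparisons contribute another odd amount.\<close>
  have "even (c q + (?g k q + ?g q k))" if q: "q \<in> S" for q
  proof -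
    have neq: "q \<noteq> k" using q k by auto
    have mem: "q \<in> set ks" "- q \<in> set ks" "- k \<in> set ks" using q S k uminus_ks by auto
    show ?thesis
      unfolding c_def pair_crossings_def
      using before_total[of "(q, Up)" "(k, Up)"] before_total[of "(q, Up)" "(- k, Down)"]
        before_total[of "(- q, Down)" "(- k, Down)"]
      using mem k neq by (simp add: mode_mem of_bool_def)
  qed
  then have "even (\<Sum>q\<in>S. c q + (?g k q + ?g q k))" by (rule dvd_sum)
  moreover have "e + ?Q S + ?Q (insert k S)
      = (\<Sum>q\<in>S. c q + (?g k q + ?g q k)) + 2 * (?Q S + ?g k k)"
    unfolding e Q by (simp add: sum.distrib)
  ultimately have "even (e + ?Q S + ?Q (insert k S))"
    by (simp only: dvd_add dvd_triv_left)
  then have "even e = even (?Q S + ?Q (insert k S))"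
    by (simp only: even_add) blast
  then have "(-1 :: complex) ^ e = (-1) ^ (?Q S + ?Q (insert k S))"
    by (auto simp: minus_one_power_iff)
  then show ?thesis unfolding e_def pair_sign_def power_add[of _ "?Q S"] .
qed

text \<open>If \<open>k\<close> is in \<open>S\<close>, the mode \<open>(- k, Down)\<close> is
  already filled. Otherwise the fermionic sign is the quotient of the signs of the new and the old
  pair state, so it cancels.\<close>

lemma create_pair_ket:
  assumes S: "S \<subseteq> set ks" and k: "k \<in> set ks"
  shows "create_pair ks k (pair_ket ks S) = (if k \<in> S then (\<lambda>n. 0) else pair_ket ks (insert k S))"
proof (cases "k \<in> S")
  case True
  then show ?thesis
    by (simp add: create_pair_def pair_ket_def creat_linear creat_ket[OF pair_occ_occupations[OF S]])
next
  case False
  note occ = pair_occ_occupations[OF S]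
  let ?n = "(pair_occ S)((- k, Down) := 1)"
  have occ': "?n \<in> occupations ks"
    using occ k uminus_ks by (intro occupations_upd) (auto simp: mode_mem)
  have "left_sum ks (k, Up) ?n
      = left_sum ks (k, Up) (pair_occ S) + of_bool (before ks (- k, Down) (k, Up))"
    using False by (intro left_sum_upd_one distinct_ks) simp
  then have "create_pair ks k (ket (pair_occ S)) = (\<lambda>n. (-1) ^ (left_sum ks (- k, Down) (pair_occ S)
      + left_sum ks (k, Up) (pair_occ S) + of_bool (before ks (- k, Down) (k, Up)))
      * ket (pair_occ (insert k S)) n)"
    using False unfolding create_pair_def pair_occ_insert creat_ket[OF occ]
    by (simp add: creat_linear creat_ket[OF occ'] del: One_nat_def) (simp add: power_add mult_ac)
  then show ?thesis
    using False unfolding pair_sign_insert[OF S k False] pair_ket_def create_pair_def creat_linear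
    by (simp flip: mult.assoc)
qed

text \<open>Annihilation undoes creation in the reverse order and meets the same left sums. So the
  sign computed for inserting \<open>k\<close> into \<open>S - {k}\<close> applies again.\<close>

lemma annih_pair_ket:
  assumes S: "S \<subseteq> set ks" and k: "k \<in> set ks"
  shows "annih_pair ks k (pair_ket ks S) = (if k \<in> S then pair_ket ks (S - {k}) else (\<lambda>n. 0))"
proof (cases "k \<in> S")
  case False
  then show ?thesis
    by (simp add: annih_pair_def pair_ket_def annih_linear annih_ket[OF pair_occ_occupations[OF S]])
next
  case True
  define T where "T = S - {k}"
  have T: "T \<subseteq> set ks" "k \<notin> T" and S_eq: "S = insert k T"
    using S True by (auto simp: T_def)
  note occ = pair_occ_occupations[OF T(1)]
  let ?n = "(pair_occ T)((- k, Down) := 1)"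
  have occ': "?n \<in> occupations ks"
    using occ k uminus_ks by (intro occupations_upd) (auto simp: mode_mem)
  have upd: "(pair_occ S)((k, Up) := 0) = ?n" "(pair_occ T)((- k, Down) := 0) = pair_occ T"
    using T(2) by (auto simp: S_eq pair_occ_insert)
  have "left_sum ks (k, Up) (pair_occ S) = left_sum ks (k, Up) ?n"
    unfolding S_eq pair_occ_insert by (simp add: left_sum_upd_self distinct_ks)
  also have "\<dots> = left_sum ks (k, Up) (pair_occ T) + of_bool (before ks (- k, Down) (k, Up))"
    using T(2) by (intro left_sum_upd_one distinct_ks) simp
  finally have "annih_pair ks k (ket (pair_occ S)) = (\<lambda>n. (-1) ^ (left_sum ks (- k, Down) (pair_occ T)
      + left_sum ks (k, Up) (pair_occ T) + of_bool (before ks (- k, Down) (k, Up)))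
      * ket (pair_occ T) n)"
    using True unfolding annih_pair_def annih_ket[OF pair_occ_occupations[OF S]] upd
    by (simp add: annih_linear annih_ket[OF occ'] upd left_sum_upd_self distinct_ks
      del: One_nat_def) (simp add: power_add mult_ac)
  then show ?thesis
    using True unfolding pair_sign_insert[OF T(1) k T(2)] pair_ket_def S_eq[symmetric] T_def[symmetric]
      annih_pair_def annih_linear
    by (simp add: mult.commute[of "pair_sign ks T"] flip: mult.assoc)
qed

text \<open>The two operators see the same occupations to the left of \<open>j\<close>, so their
  signs multiply to 1.\<close>

lemma number_ket:
  assumes n: "n \<in> occupations ks" and j: "j \<in> set (modes ks)"
  shows "creat ks j (annih ks j (ket n)) = (\<lambda>n'. of_nat (n j) * ket n n')"
proof (cases "n j = 1")
  case True
  have "n(j := 0) \<in> occupations ks" using n j by (intro occupations_upd) auto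
  moreover have "n(j := 1) = n" using True by auto
  ultimately show ?thesis
    using True by (simp add: annih_ket[OF n] creat_linear creat_ket left_sum_upd_self distinct_ks
      flip: mult.assoc power_mult_distrib)
next
  case False
  then have "n j = 0" using n j by (auto simp: occupations_def)
  then show ?thesis by (simp add: annih_ket[OF n] creat_linear)
qed

end

section \<open>Coordinates with respect to the pair states\<close>

lemma pair_vec_scale: "c * pair_vec ks f n = pair_vec ks (\<lambda>S. c * f S) n"
  by (simp add: pair_vec_def sum_distrib_left mult.assoc)

lemma pair_vec_add: "pair_vec ks f n + pair_vec ks g n = pair_vec ks (\<lambda>S. f S + g S) n"
  by (simp add: pair_vec_def sum.distrib ring_distribs)

lemma pair_vec_diff: "pair_vec ks f n - pair_vec ks g n = pair_vec ks (\<lambda>S. f S - g S) n"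
  by (simp add: pair_vec_def sum_subtractf ring_distribs)

lemma pair_vec_sum: "(\<Sum>x\<in>X. pair_vec ks (f x) n) = pair_vec ks (\<lambda>S. \<Sum>x\<in>X. f x S) n"
  unfolding pair_vec_def sum_distrib_right by (rule sum.swap)

lemma pair_vec_cong:
  "(\<And>S. S \<subseteq> set ks \<Longrightarrow> f S = g S) \<Longrightarrow> pair_vec ks f = pair_vec ks g"
  unfolding pair_vec_def by (intro ext sum.cong) auto

lemma pair_vec_at:
  assumes "T \<subseteq> set ks"
  shows "pair_vec ks f (pair_occ T) = f T * pair_sign ks T"
proof -
  have "pair_vec ks f (pair_occ T)
      = (\<Sum>S\<in>Pow (set ks). if S = T then f T * pair_sign ks T else 0)"
    unfolding pair_vec_def pair_ket_def ket_def by (intro sum.cong) (auto simp: pair_occ_inject)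
  then show ?thesis using assms by simp
qed

lemma pair_vec_outside: "n \<notin> pair_occ ` Pow (set ks) \<Longrightarrow> pair_vec ks f n = 0"
  unfolding pair_vec_def pair_ket_def ket_def by (intro sum.neutral) auto

text \<open>Expansion of a product of binomials, read backwards. It factorizes over the momenta
  every sum over pair sets of a product of one-momentum weights.\<close>

lemma sum_Pow_prod_if:
  fixes g h :: "'a \<Rightarrow> 'b::comm_semiring_1"
  assumes "finite A"
  shows "(\<Sum>S\<in>Pow A. \<Prod>j\<in>A. if j \<in> S then g j else h j) = (\<Prod>j\<in>A. g j + h j)"
proof -
  have "(\<Prod>j\<in>A. if j \<in> S then g j else h j) = (\<Prod>j\<in>S. g j) * (\<Prod>j\<in>A - S. h j)"
    if "S \<subseteq> A" for S
  proof -
    have "A \<inter> S = S" using that by blast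
    then show ?thesis
      using prod.If_cases[OF assms, of "\<lambda>j. j \<in> S" g h] by (simp add: Diff_eq Compl_eq)
  qed
  then show ?thesis by (simp add: prod_add[OF assms])
qed

context momentum_list
begin

text \<open>Inserting \<open>k\<close> is a bijection from the sets without \<open>k\<close> onto
  those with \<open>k\<close>. In coordinates the new amplitude is therefore read off at the
  preimage.\<close>

lemma create_pair_vec:
  assumes k: "k \<in> set ks"
  shows "create_pair ks k (pair_vec ks f) = pair_vec ks (\<lambda>S. if k \<in> S then f (S - {k}) else 0)"
proof
  fix n
  have "create_pair ks k (pair_vec ks f) n
      = (\<Sum>S\<in>Pow (set ks). f S * create_pair ks k (pair_ket ks S) n)"
    unfolding pair_vec_def create_pair_def creat_linear ..
  also have "\<dots> = (\<Sum>S\<in>{S\<in>Pow (set ks). k \<notin> S}. f S * pair_ket ks (insert k S) n)"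
    using k by (intro sum.mono_neutral_cong_right) (auto simp: create_pair_ket)
  also have "\<dots> = (\<Sum>S\<in>{S\<in>Pow (set ks). k \<in> S}. f (S - {k}) * pair_ket ks S n)"
    using k by (intro sum.reindex_bij_witness[of _ "\<lambda>S. S - {k}" "insert k"]) (auto simp: insert_absorb)
  also have "\<dots> = pair_vec ks (\<lambda>S. if k \<in> S then f (S - {k}) else 0) n"
    unfolding pair_vec_def by (intro sum.mono_neutral_cong_left) auto
  finally show "create_pair ks k (pair_vec ks f) n
      = pair_vec ks (\<lambda>S. if k \<in> S then f (S - {k}) else 0) n" .
qed

lemma annih_pair_vec:
  assumes k: "k \<in> set ks"
  shows "annih_pair ks k (pair_vec ks f) = pair_vec ks (\<lambda>S. if k \<in> S then 0 else f (insert k S))"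
proof
  fix n
  have "annih_pair ks k (pair_vec ks f) n
      = (\<Sum>S\<in>Pow (set ks). f S * annih_pair ks k (pair_ket ks S) n)"
    unfolding pair_vec_def annih_pair_def annih_linear ..
  also have "\<dots> = (\<Sum>S\<in>{S\<in>Pow (set ks). k \<in> S}. f S * pair_ket ks (S - {k}) n)"
    using k by (intro sum.mono_neutral_cong_right) (auto simp: annih_pair_ket)
  also have "\<dots> = (\<Sum>S\<in>{S\<in>Pow (set ks). k \<notin> S}. f (insert k S) * pair_ket ks S n)"
    using k by (intro sum.reindex_bij_witness[of _ "insert k" "\<lambda>S. S - {k}"]) (auto simp: insert_absorb)
  also have "\<dots> = pair_vec ks (\<lambda>S. if k \<in> S then 0 else f (insert k S)) n"
    unfolding pair_vec_def by (intro sum.mono_neutral_cong_left) auto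
  finally show "annih_pair ks k (pair_vec ks f) n
      = pair_vec ks (\<lambda>S. if k \<in> S then 0 else f (insert k S)) n" .
qed

lemma number_pair_vec:
  assumes k: "k \<in> set ks"
  shows "creat ks (k, \<sigma>) (annih ks (k, \<sigma>) (pair_vec ks f))
    = pair_vec ks (\<lambda>S. of_nat (pair_occ S (k, \<sigma>)) * f S)"
proof -
  have "creat ks (k, \<sigma>) (annih ks (k, \<sigma>) (pair_ket ks S))
      = (\<lambda>n. of_nat (pair_occ S (k, \<sigma>)) * pair_ket ks S n)" if "S \<subseteq> set ks" for S
    unfolding pair_ket_def annih_linear creat_linear
      number_ket[OF pair_occ_occupations[OF that] mode_mem[OF k]]
    by (simp add: mult.left_commute)
  then show ?thesis
    unfolding pair_vec_def annih_linear creat_linear by (intro ext sum.cong) auto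
qed

text \<open>The signed pair states are orthonormal: distinct sets have distinct labels, and the
  signs square to 1.\<close>

lemma braket_pair_vec:
  "braket ks (pair_vec ks f) (pair_vec ks g) = (\<Sum>S\<in>Pow (set ks). cnj (f S) * g S)"
proof -
  have "braket ks (pair_vec ks f) (pair_vec ks g)
      = (\<Sum>n\<in>pair_occ ` Pow (set ks). cnj (pair_vec ks f n) * pair_vec ks g n)"
    unfolding braket_def using finite_occupations pair_occ_occupations pair_vec_outside
    by (intro sum.mono_neutral_right) auto
  also have "\<dots> = (\<Sum>S\<in>Pow (set ks). cnj (pair_vec ks f (pair_occ S)) * pair_vec ks g (pair_occ S))"
    by (subst sum.reindex) (auto simp: inj_on_def pair_occ_inject)
  also have "\<dots> = (\<Sum>S\<in>Pow (set ks). cnj (f S) * g S)"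
  proof (intro sum.cong refl)
    fix S assume "S \<in> Pow (set ks)"
    then have "cnj (pair_vec ks f (pair_occ S)) * pair_vec ks g (pair_occ S)
        = (pair_sign ks S * pair_sign ks S) * (cnj (f S) * g S)"
      by (simp add: pair_vec_at del: pair_sign_simps(2))
    then show "cnj (pair_vec ks f (pair_occ S)) * pair_vec ks g (pair_occ S) = cnj (f S) * g S"
      by simp
  qed
  finally show ?thesis .
qed

text \<open>The interaction moves a pair from \<open>k\<close> to \<open>k'\<close>, so the new
  amplitude at \<open>S\<close> comes from the set in which \<open>k'\<close> is replaced by
  \<open>k\<close>. In the kinetic part, the mode \<open>(k, Down)\<close> belongs to the pair
  \<open>- k\<close>.\<close>

lemma Hamiltonian_pair_vec:
  "BCS_Hamiltonian ks \<xi> U (pair_vec ks f) = pair_vec ks (\<lambda>S.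
     (\<Sum>k\<in>set ks. of_real (\<xi> k) * ((of_bool (k \<in> S) + of_bool (- k \<in> S)) * f S)) +
     (\<Sum>k\<in>set ks. \<Sum>k'\<in>set ks. of_real (U k k') *
        (if k' \<in> S then if k \<in> S - {k'} then 0 else f (insert k (S - {k'})) else 0)))"
proof
  fix n
  have 1: "(\<Sum>k\<in>set ks. \<Sum>\<sigma>\<in>{Up, Down}. of_real (\<xi> k) *
        creat ks (k, \<sigma>) (annih ks (k, \<sigma>) (pair_vec ks f)) n)
    = (\<Sum>k\<in>set ks. pair_vec ks
        (\<lambda>S. of_real (\<xi> k) * ((of_bool (k \<in> S) + of_bool (- k \<in> S)) * f S)) n)"
    by (intro sum.cong refl)
      (simp add: number_pair_vec pair_vec_scale pair_vec_add ring_distribs)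
  have 2: "(\<Sum>k\<in>set ks. \<Sum>k'\<in>set ks. of_real (U k k') * creat ks (k', Up) (creat ks (- k', Down)
        (annih ks (- k, Down) (annih ks (k, Up) (pair_vec ks f)))) n)
    = (\<Sum>k\<in>set ks. \<Sum>k'\<in>set ks. pair_vec ks (\<lambda>S. of_real (U k k') *
        (if k' \<in> S then if k \<in> S - {k'} then 0 else f (insert k (S - {k'})) else 0)) n)"
    unfolding annih_pair_def[symmetric] create_pair_def[symmetric]
    by (intro sum.cong refl) (simp only: annih_pair_vec create_pair_vec pair_vec_scale)
  show "BCS_Hamiltonian ks \<xi> U (pair_vec ks f) n = pair_vec ks (\<lambda>S.
     (\<Sum>k\<in>set ks. of_real (\<xi> k) * ((of_bool (k \<in> S) + of_bool (- k \<in> S)) * f S)) +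
     (\<Sum>k\<in>set ks. \<Sum>k'\<in>set ks. of_real (U k k') *
        (if k' \<in> S then if k \<in> S - {k'} then 0 else f (insert k (S - {k'})) else 0))) n"
    unfolding BCS_Hamiltonian_def 1 2 pair_vec_sum pair_vec_add ..
qed

end

section \<open>Exponential series on eigenvectors and product amplitudes\<close>

lemma op_exp_eigenvectors:
  assumes "finite X"
    and lin: "\<And>c. A (\<lambda>n. \<Sum>x\<in>X. c x * \<psi> x n) = (\<lambda>n. \<Sum>x\<in>X. c x * A (\<psi> x) n)"
    and eigen: "\<And>x. x \<in> X \<Longrightarrow> A (\<psi> x) = (\<lambda>n. ev x * \<psi> x n)"
  shows "op_exp A (\<lambda>n. \<Sum>x\<in>X. c x * \<psi> x n) = (\<lambda>n. \<Sum>x\<in>X. c x * exp (ev x) * \<psi> x n)"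
proof
  fix n
  have pow: "(A ^^ r) (\<lambda>n. \<Sum>x\<in>X. c x * \<psi> x n) = (\<lambda>n. \<Sum>x\<in>X. (c x * ev x ^ r) * \<psi> x n)" for r
  proof (induction r)
    case (Suc r)
    show ?case
      unfolding funpow.simps comp_def Suc.IH lin
      by (intro ext sum.cong refl) (simp add: eigen)
  qed simp
  \<comment> \<open>A power of \<open>A\<close> multiplies each eigenvector by a power of its
    eigenvalue. Each coordinate is thus a finite combination of scalar exponential series, which may
    be summed separately.\<close>
  have "(\<lambda>r. \<Sum>x\<in>X. c x * \<psi> x n * (ev x ^ r /\<^sub>R fact r)) sums (\<Sum>x\<in>X. c x * \<psi> x n * exp (ev x))"
    by (intro sums_sum sums_mult exp_converges)
  also have "(\<lambda>r. \<Sum>x\<in>X. c x * \<psi> x n * (ev x ^ r /\<^sub>R fact r))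
      = (\<lambda>r. (A ^^ r) (\<lambda>n. \<Sum>x\<in>X. c x * \<psi> x n) n / fact r)"
    unfolding pow sum_divide_distrib
    by (intro ext sum.cong) (simp_all add: scaleR_conv_of_real divide_simps)
  finally show "op_exp A (\<lambda>n. \<Sum>x\<in>X. c x * \<psi> x n) n = (\<Sum>x\<in>X. c x * exp (ev x) * \<psi> x n)"
    unfolding op_exp_def by (simp add: sums_unique[symmetric] mult_ac)
qed

text \<open>A product state: independently of the others, the pair \<open>j\<close> is empty with
  amplitude \<open>u j\<close> and occupied with amplitude \<open>v j\<close>.\<close>

definition pair_amp ::
  "(real^3) list \<Rightarrow> (real^3 \<Rightarrow> real) \<Rightarrow> (real^3 \<Rightarrow> real) \<Rightarrow> (real^3) set \<Rightarrow> real" where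
  "pair_amp ks u v S = (\<Prod>j\<in>set ks. if j \<in> S then v j else u j)"

text \<open>For one pair the exponent is \<open>\<theta>\<close> times a quarter-turn generator,
  sending the amplitudes (empty, occupied) = (1, p) to (-p, 1). This is a multiple of (1, p), namely
  by -p, exactly when p squared is -1. The set \<open>T\<close> records which root each pair
  takes.\<close>

definition eigen_phase :: "(real^3) set \<Rightarrow> real^3 \<Rightarrow> complex" where
  "eigen_phase T j = (if j \<in> T then - \<i> else \<i>)"

definition eigen_state :: "(real^3) list \<Rightarrow> (real^3) set \<Rightarrow> state" where
  "eigen_state ks T = pair_vec ks (\<lambda>S. \<Prod>j\<in>S. eigen_phase T j)"

text \<open>The sum over \<open>T\<close> factorizes over the momenta. Each factor is half a sum of
  two conjugate exponentials with phases, which Euler's formulas turn into \<open>cos\<close> for an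
  empty and \<open>sin\<close> for an occupied pair.\<close>

lemma pair_amp_expansion:
  assumes S: "S \<subseteq> set ks"
  shows "(\<Sum>T\<in>Pow (set ks). (1/2) ^ card (set ks) *
      exp (- (\<Sum>k\<in>set ks. of_real (\<theta> k) * eigen_phase T k)) * (\<Prod>j\<in>S. eigen_phase T j))
    = of_real (pair_amp ks (\<lambda>k. cos (\<theta> k)) (\<lambda>k. sin (\<theta> k)) S)"
proof -
  let ?A = "set ks"
  have "(1/2) ^ card ?A * exp (- (\<Sum>k\<in>?A. of_real (\<theta> k) * eigen_phase T k)) * (\<Prod>j\<in>S. eigen_phase T j)
      = (\<Prod>j\<in>?A. if j \<in> T then (1/2) * exp (\<i> * \<theta> j) * (if j \<in> S then - \<i> else 1)
                   else (1/2) * exp (- (\<i> * \<theta> j)) * (if j \<in> S then \<i> else 1))" for T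
  proof -
    have 1: "exp (- (\<Sum>k\<in>?A. of_real (\<theta> k) * eigen_phase T k))
        = (\<Prod>k\<in>?A. exp (- (of_real (\<theta> k) * eigen_phase T k)))"
      by (simp add: exp_sum flip: sum_negf)
    have 2: "(\<Prod>j\<in>S. eigen_phase T j) = (\<Prod>j\<in>?A. if j \<in> S then eigen_phase T j else 1)"
      using S by (intro prod.mono_neutral_cong_left) auto
    have 3: "(1/2 :: complex) ^ card ?A = (\<Prod>j\<in>?A. 1/2)" by simp
    show ?thesis
      unfolding 1 2 3 prod.distrib[symmetric]
      by (intro prod.cong) (auto simp: eigen_phase_def mult.commute)
  qed
  then have "(\<Sum>T\<in>Pow ?A. (1/2) ^ card ?A *
      exp (- (\<Sum>k\<in>?A. of_real (\<theta> k) * eigen_phase T k)) * (\<Prod>j\<in>S. eigen_phase T j))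
    = (\<Prod>j\<in>?A. (1/2) * exp (\<i> * \<theta> j) * (if j \<in> S then - \<i> else 1)
                + (1/2) * exp (- (\<i> * \<theta> j)) * (if j \<in> S then \<i> else 1))"
    by (simp only: sum_Pow_prod_if[OF finite_set])
  also have "\<dots> = (\<Prod>j\<in>?A. of_real (if j \<in> S then sin (\<theta> j) else cos (\<theta> j)))"
    by (intro prod.cong refl)
      (auto simp: sin_of_real[symmetric] cos_of_real[symmetric] sin_exp_eq cos_exp_eq field_simps)
  also have "\<dots> = of_real (pair_amp ks (\<lambda>k. cos (\<theta> k)) (\<lambda>k. sin (\<theta> k)) S)"
    by (simp add: pair_amp_def)
  finally show ?thesis .
qed

text \<open>Any momentum on which \<open>S\<close> and \<open>F\<close> disagree contributes a
  factor 0. This presents both the vacuum and the Fermi vacuum as product states.\<close>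

lemma pair_amp_indicator:
  assumes "S \<subseteq> set ks" "F \<subseteq> set ks"
  shows "pair_amp ks (\<lambda>k. of_bool (k \<notin> F)) (\<lambda>k. of_bool (k \<in> F)) S = of_bool (S = F)"
proof (cases "S = F")
  case True
  then show ?thesis by (auto simp: pair_amp_def intro!: prod.neutral)
next
  case False
  then obtain j where "j \<in> set ks" "(j \<in> S) \<noteq> (j \<in> F)" using assms by blast
  then show ?thesis using False by (auto simp: pair_amp_def intro!: prod_zero)
qed

lemma vacuum_pair_vec: "vacuum = pair_vec ks (\<lambda>S. of_bool (S = {}))"
proof
  fix n
  have "pair_occ {} = (\<lambda>_. 0)" by (auto simp: pair_occ_def split: spin.split)
  moreover have "pair_vec ks (\<lambda>S. of_bool (S = {})) n
      = (\<Sum>S\<in>Pow (set ks). if S = {} then pair_ket ks {} n else 0)"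
    unfolding pair_vec_def by (intro sum.cong) auto
  ultimately show "vacuum n = pair_vec ks (\<lambda>S. of_bool (S = {})) n"
    by (simp add: pair_ket_def vacuum_def)
qed

section \<open>Expectation values in product states\<close>

lemma pair_amp_mean_number:
  assumes norm: "\<And>j. j \<in> set ks \<Longrightarrow> u j ^ 2 + v j ^ 2 = 1" and k: "k \<in> set ks"
  shows "(\<Sum>S\<in>Pow (set ks). of_bool (k \<in> S) * pair_amp ks u v S ^ 2) = v k ^ 2"
proof -
  \<comment> \<open>Setting the empty weight at \<open>k\<close> to 0 enforces that \<open>k\<close>
    lies in \<open>S\<close>. All other factors then sum to 1 by normalization.\<close>
  let ?h = "\<lambda>j. if j = k then 0 else u j ^ 2"
  have "of_bool (k \<in> S) * pair_amp ks u v S ^ 2 = (\<Prod>j\<in>set ks. if j \<in> S then v j ^ 2 else ?h j)" for S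
  proof (cases "k \<in> S")
    case True
    then show ?thesis
      unfolding pair_amp_def prod_power_distrib by (auto intro!: prod.cong)
  next
    case False
    then show ?thesis using k by (auto intro!: prod_zero[symmetric])
  qed
  then have "(\<Sum>S\<in>Pow (set ks). of_bool (k \<in> S) * pair_amp ks u v S ^ 2)
      = (\<Prod>j\<in>set ks. v j ^ 2 + ?h j)"
    by (simp only: sum_Pow_prod_if[OF finite_set])
  also have "\<dots> = (\<Prod>j\<in>set ks. if j = k then v k ^ 2 else 1)"
    using norm by (intro prod.cong) (auto simp: add.commute)
  finally show ?thesis using k by simp
qed

text \<open>The amplitudes before and after the hop agree away from \<open>k\<close> and
  \<open>k'\<close>, where they give squares that sum to 1. At each of the two ends the pair is
  occupied in one amplitude and empty in the other, giving \<open>u * v\<close>.\<close>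

lemma pair_amp_mean_hopping:
  assumes norm: "\<And>j. j \<in> set ks \<Longrightarrow> u j ^ 2 + v j ^ 2 = 1"
    and k: "k \<in> set ks" "k' \<in> set ks" "k \<noteq> k'"
  shows "(\<Sum>S\<in>Pow (set ks). pair_amp ks u v S *
      (if k' \<in> S then if k \<in> S - {k'} then 0 else pair_amp ks u v (insert k (S - {k'})) else 0))
    = u k * v k * (u k' * v k')"
proof -
  \<comment> \<open>The zeros in \<open>?g\<close> and \<open>?h\<close> discard every
    \<open>S\<close> that contains \<open>k\<close> or lacks \<open>k'\<close>.\<close>
  let ?g = "\<lambda>j. if j = k then 0 else if j = k' then u j * v j else v j ^ 2"
  let ?h = "\<lambda>j. if j = k then u j * v j else if j = k' then 0 else u j ^ 2"
  have "pair_amp ks u v S *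
      (if k' \<in> S then if k \<in> S - {k'} then 0 else pair_amp ks u v (insert k (S - {k'})) else 0)
    = (\<Prod>j\<in>set ks. if j \<in> S then ?g j else ?h j)" for S
  proof (cases "k' \<in> S \<and> k \<notin> S")
    case True
    then show ?thesis
      unfolding pair_amp_def using k(3)
      by (auto simp: power2_eq_square mult.commute intro!: prod.cong simp flip: prod.distrib)
  next
    case False
    then have "(\<Prod>j\<in>set ks. if j \<in> S then ?g j else ?h j) = 0"
      using k by (intro prod_zero) auto
    then show ?thesis using False k by auto
  qed
  then have "(\<Sum>S\<in>Pow (set ks). pair_amp ks u v S *
      (if k' \<in> S then if k \<in> S - {k'} then 0 else pair_amp ks u v (insert k (S - {k'})) else 0))
    = (\<Prod>j\<in>set ks. ?g j + ?h j)"
    by (simp only: sum_Pow_prod_if[OF finite_set])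
  also have "\<dots> = (\<Prod>j\<in>set ks. (if j = k then u k * v k else 1) * (if j = k' then u k' * v k' else 1))"
    using norm k(3) by (intro prod.cong) (auto simp: add.commute)
  also have "\<dots> = u k * v k * (u k' * v k')"
    using k by (simp add: prod.distrib)
  finally show ?thesis .
qed

section \<open>The BCS state and the Fermi vacuum as product states\<close>

context momentum_list
begin

lemma Bogoliubov_pair_vec:
  "\<i> * Bogoliubov_generator ks \<theta> (pair_vec ks f) n = pair_vec ks (\<lambda>S. \<Sum>k\<in>set ks. of_real (\<theta> k) *
     ((if k \<in> S then f (S - {k}) else 0) - (if k \<in> S then 0 else f (insert k S)))) n"
proof -
  have "\<i> * Bogoliubov_generator ks \<theta> (pair_vec ks f) n = (\<Sum>k\<in>set ks. of_real (\<theta> k) *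
      (create_pair ks k (pair_vec ks f) n - annih_pair ks k (pair_vec ks f) n))"
    unfolding Bogoliubov_generator_def create_pair_def annih_pair_def
    by (simp add: right_diff_distrib sum_subtractf flip: mult.assoc)
  also have "\<dots> = (\<Sum>k\<in>set ks. pair_vec ks (\<lambda>S. of_real (\<theta> k) *
     ((if k \<in> S then f (S - {k}) else 0) - (if k \<in> S then 0 else f (insert k S)))) n)"
    by (intro sum.cong refl)
      (simp only: create_pair_vec annih_pair_vec pair_vec_diff pair_vec_scale)
  finally show ?thesis unfolding pair_vec_sum .
qed

lemma Bogoliubov_eigen_state:
  "(\<lambda>n. \<i> * Bogoliubov_generator ks \<theta> (eigen_state ks T) n)
    = (\<lambda>n. - (\<Sum>k\<in>set ks. of_real (\<theta> k) * eigen_phase T k) * eigen_state ks T n)"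
proof -
  have "(if k \<in> S then \<Prod>j\<in>S - {k}. eigen_phase T j else 0)
      - (if k \<in> S then 0 else \<Prod>j\<in>insert k S. eigen_phase T j)
      = - eigen_phase T k * (\<Prod>j\<in>S. eigen_phase T j)" if "S \<subseteq> set ks" for S k
  proof (cases "k \<in> S")
    case True
    \<comment> \<open>Removing \<open>k\<close> divides the product by its phase, which is the same
      as multiplying by minus the phase.\<close>
    have "eigen_phase T k * eigen_phase T k = -1" by (simp add: eigen_phase_def)
    then show ?thesis
      using True finite_subset_ks[OF that]
      by (simp add: prod.remove[of S k] flip: mult.assoc)
  next
    case False
    then show ?thesis using finite_subset_ks[OF that] by simp
  qed
  then show ?thesis
    unfolding eigen_state_def Bogoliubov_pair_vec pair_vec_scale
    by (intro ext fun_cong[OF pair_vec_cong]) (simp add: sum_distrib_right mult.assoc flip: sum_negf)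
qed

lemma Bogoliubov_linear:
  "Bogoliubov_generator ks \<theta> (\<lambda>n. \<Sum>x\<in>X. c x * \<psi> x n)
    = (\<lambda>n. \<Sum>x\<in>X. c x * Bogoliubov_generator ks \<theta> (\<psi> x) n)"
proof
  fix n
  let ?B = "\<lambda>x k. annih ks (- k, Down) (annih ks (k, Up) (\<psi> x)) n
    - creat ks (k, Up) (creat ks (- k, Down) (\<psi> x)) n"
  have "Bogoliubov_generator ks \<theta> (\<lambda>n. \<Sum>x\<in>X. c x * \<psi> x n) n
      = \<i> * (\<Sum>k\<in>set ks. of_real (\<theta> k) * (\<Sum>x\<in>X. c x * ?B x k))"
    unfolding Bogoliubov_generator_def annih_linear creat_linear
    by (simp add: sum_subtractf right_diff_distrib)
  also have "\<dots> = (\<Sum>k\<in>set ks. \<Sum>x\<in>X. c x * (\<i> * (of_real (\<theta> k) * ?B x k)))"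
    by (simp add: sum_distrib_left mult_ac)
  also have "\<dots> = (\<Sum>x\<in>X. \<Sum>k\<in>set ks. c x * (\<i> * (of_real (\<theta> k) * ?B x k)))"
    by (rule sum.swap)
  finally show "Bogoliubov_generator ks \<theta> (\<lambda>n. \<Sum>x\<in>X. c x * \<psi> x n) n
      = (\<Sum>x\<in>X. c x * Bogoliubov_generator ks \<theta> (\<psi> x) n)"
    unfolding Bogoliubov_generator_def by (simp add: sum_distrib_left)
qed

lemma eigen_state_sum:
  "(\<lambda>n. \<Sum>T\<in>Pow (set ks). (1/2) ^ card (set ks) *
      exp (- (\<Sum>k\<in>set ks. of_real (\<theta> k) * eigen_phase T k)) * eigen_state ks T n)
    = pair_vec ks (\<lambda>S. of_real (pair_amp ks (\<lambda>k. cos (\<theta> k)) (\<lambda>k. sin (\<theta> k)) S))"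
  unfolding eigen_state_def pair_vec_scale pair_vec_sum
  by (intro ext fun_cong[OF pair_vec_cong]) (simp only: pair_amp_expansion)

text \<open>At zero angles, the expansion into eigenvectors of the generator is that of the vacuum.\<close>

lemma BCS_state_pair_vec:
  "BCS_state ks \<theta> = pair_vec ks (\<lambda>S. of_real (pair_amp ks (\<lambda>k. cos (\<theta> k)) (\<lambda>k. sin (\<theta> k)) S))"
proof -
  have "vacuum = pair_vec ks (\<lambda>S. of_real (pair_amp ks (\<lambda>k. cos 0) (\<lambda>k. sin 0) S))"
    unfolding vacuum_pair_vec[of ks]
    using pair_amp_indicator[where F = "{}"] by (intro pair_vec_cong) simp
  also have "\<dots> = (\<lambda>n. \<Sum>T\<in>Pow (set ks). (1/2) ^ card (set ks) * eigen_state ks T n)"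
    using eigen_state_sum[of "\<lambda>_. 0"] by simp
  finally have vacuum: "vacuum = \<dots>" .
  \<comment> \<open>Vacuum and target are superpositions of the same eigenvectors; the coefficients
    differ exactly by the exponentials of the eigenvalues.\<close>
  show ?thesis
    unfolding BCS_state_def eigen_state_sum[symmetric] vacuum
  proof (rule op_exp_eigenvectors)
    show "(\<lambda>n. \<i> * Bogoliubov_generator ks \<theta> (\<lambda>n. \<Sum>T\<in>Pow (set ks). c T * eigen_state ks T n) n)
        = (\<lambda>n. \<Sum>T\<in>Pow (set ks). c T * (\<i> * Bogoliubov_generator ks \<theta> (eigen_state ks T) n))" for c
      unfolding Bogoliubov_linear by (simp add: sum_distrib_left mult.left_commute)
  qed (simp_all add: Bogoliubov_eigen_state)
qed

text \<open>Each factor inserts a momentum not yet present, since the list has no repetitions. Pair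
  creations act without signs here, so only the set of inserted momenta remains.\<close>

lemma Fermi_vacuum_pair_vec:
  "Fermi_vacuum ks \<xi> = pair_vec ks (\<lambda>S. of_bool (S = {k \<in> set ks. \<xi> k \<le> 0}))"
proof -
  have "foldr (create_pair ks) xs vacuum = pair_vec ks (\<lambda>S. of_bool (S = set xs))"
    if "distinct xs" "set xs \<subseteq> set ks" for xs
    using that
  proof (induction xs)
    case (Cons x xs)
    then show ?case
      by (auto simp: create_pair_vec intro!: pair_vec_cong)
  qed (simp add: vacuum_pair_vec[of ks])
  from this[of "filter (\<lambda>k. \<xi> k \<le> 0) ks"] show ?thesis
    unfolding Fermi_vacuum_def create_pair_def[abs_def] by (simp add: distinct_ks)
qed

section \<open>Energy of product states and the energy difference\<close>

lemma pair_amp_energy: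
  assumes norm: "\<And>j. j \<in> set ks \<Longrightarrow> u j ^ 2 + v j ^ 2 = 1"
    and U_diag: "\<And>k. k \<in> set ks \<Longrightarrow> U k k = 0"
  defines "\<psi> \<equiv> pair_vec ks (\<lambda>S. of_real (pair_amp ks u v S))"
  shows "braket ks \<psi> (BCS_Hamiltonian ks \<xi> U \<psi>) =
    of_real ((\<Sum>k\<in>set ks. \<xi> k * (v k ^ 2 + v (- k) ^ 2)) +
      (\<Sum>k\<in>set ks. \<Sum>k'\<in>set ks. U k k' * (u k * v k * (u k' * v k'))))"
proof -
  let ?f = "pair_amp ks u v" and ?P = "Pow (set ks)"
  let ?hop = "\<lambda>k k' S. if k' \<in> S then if k \<in> S - {k'} then 0 else ?f (insert k (S - {k'})) else 0"
  \<comment> \<open>All amplitudes and couplings are real, so the coercion can be pulled out of the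
    whole expression.\<close>
  have "braket ks \<psi> (BCS_Hamiltonian ks \<xi> U \<psi>) = of_real (\<Sum>S\<in>?P. ?f S *
      ((\<Sum>k\<in>set ks. \<xi> k * ((of_bool (k \<in> S) + of_bool (- k \<in> S)) * ?f S)) +
       (\<Sum>k\<in>set ks. \<Sum>k'\<in>set ks. U k k' * ?hop k k' S)))"
  proof -
    have "(if k' \<in> S then if k \<in> S - {k'} then 0 else complex_of_real (?f (insert k (S - {k'}))) else 0)
        = of_real (?hop k k' S)" for k k' S
      by simp
    moreover have "of_bool b = complex_of_real (of_bool b)" for b by simp
    ultimately show ?thesis
      unfolding \<psi>_def Hamiltonian_pair_vec braket_pair_vec
      by (simp only: complex_cnj_complex_of_real flip: of_real_mult of_real_add of_real_sum)
  qed
  also have "(\<Sum>S\<in>?P. ?f S *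
      ((\<Sum>k\<in>set ks. \<xi> k * ((of_bool (k \<in> S) + of_bool (- k \<in> S)) * ?f S)) +
       (\<Sum>k\<in>set ks. \<Sum>k'\<in>set ks. U k k' * ?hop k k' S)))
    = (\<Sum>k\<in>set ks. \<xi> k * ((\<Sum>S\<in>?P. of_bool (k \<in> S) * ?f S ^ 2) + (\<Sum>S\<in>?P. of_bool (- k \<in> S) * ?f S ^ 2)))
      + (\<Sum>k\<in>set ks. \<Sum>k'\<in>set ks. U k k' * (\<Sum>S\<in>?P. ?f S * ?hop k k' S))"
  proof -
    have 1: "(\<Sum>S\<in>?P. ?f S * (\<Sum>k\<in>set ks. \<xi> k * ((of_bool (k \<in> S) + of_bool (- k \<in> S)) * ?f S)))
      = (\<Sum>k\<in>set ks. \<xi> k * ((\<Sum>S\<in>?P. of_bool (k \<in> S) * ?f S ^ 2) + (\<Sum>S\<in>?P. of_bool (- k \<in> S) * ?f S ^ 2)))"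
      unfolding sum_distrib_left sum.distrib[symmetric]
      by (subst sum.swap) (intro sum.cong refl, simp add: algebra_simps power2_eq_square)
    have 2: "(\<Sum>S\<in>?P. ?f S * (\<Sum>k\<in>set ks. \<Sum>k'\<in>set ks. U k k' * ?hop k k' S))
      = (\<Sum>k\<in>set ks. \<Sum>k'\<in>set ks. \<Sum>S\<in>?P. U k k' * (?f S * ?hop k k' S))"
      unfolding sum_distrib_left
      by (subst sum.swap, subst (2) sum.swap) (intro sum.cong refl mult.left_commute)
    show ?thesis unfolding distrib_left sum.distrib 1[unfolded distrib_left sum.distrib] 2[unfolded distrib_left sum.distrib]
      by (simp add: sum_distrib_left)
  qed
  also have "(\<Sum>k\<in>set ks. \<xi> k * ((\<Sum>S\<in>?P. of_bool (k \<in> S) * ?f S ^ 2) + (\<Sum>S\<in>?P. of_bool (- k \<in> S) * ?f S ^ 2)))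
      = (\<Sum>k\<in>set ks. \<xi> k * (v k ^ 2 + v (- k) ^ 2))"
    using uminus_ks by (intro sum.cong refl) (simp only: pair_amp_mean_number[OF norm])
  also have "(\<Sum>k\<in>set ks. \<Sum>k'\<in>set ks. U k k' * (\<Sum>S\<in>?P. ?f S * ?hop k k' S))
      = (\<Sum>k\<in>set ks. \<Sum>k'\<in>set ks. U k k' * (u k * v k * (u k' * v k')))"
  proof (intro sum.cong refl)
    fix k k' assume k: "k \<in> set ks" "k' \<in> set ks"
    show "U k k' * (\<Sum>S\<in>?P. ?f S * ?hop k k' S) = U k k' * (u k * v k * (u k' * v k'))"
    proof (cases "k = k'")
      \<comment> \<open>The diagonal expectation would be \<open>v k ^ 2\<close> and not the square
        of \<open>u k * v k\<close>; the vanishing of \<open>U k k\<close> removes this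
        term.\<close>
      case True
      then show ?thesis using U_diag k by simp
    next
      case False
      show ?thesis by (simp only: pair_amp_mean_hopping[OF norm k False])
    qed
  qed
  finally show ?thesis .
qed

end

lemma uminus_momenta:
  assumes "k \<in> momenta L Kmax"
  shows "- k \<in> momenta L Kmax"
proof -
  obtain n1 n2 n3 :: int where
    k: "k = (2 * pi / L) *\<^sub>R vector [of_int n1, of_int n2, of_int n3]"
    and n: "2 * pi / L * sqrt (of_int n1 ^ 2 + of_int n2 ^ 2 + of_int n3 ^ 2) \<le> Kmax"
    using assms unfolding momenta_def by blast
  have "- k = (2 * pi / L) *\<^sub>R vector [of_int (- n1), of_int (- n2), of_int (- n3)]"
    unfolding k by (simp add: vec_eq_iff forall_3)
  moreover have "2 * pi / L * sqrt (of_int (- n1) ^ 2 + of_int (- n2) ^ 2 + of_int (- n3) ^ 2) \<le> Kmax"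
    using n by simp
  ultimately show ?thesis unfolding momenta_def by blast
qed

theorem proposition4p2:
  fixes L Kmax hbar m mu :: real
    and ks :: "(real^3) list" and \<Lambda> :: "(real^3) set"
    and \<xi> \<Delta> \<theta> :: "real^3 \<Rightarrow> real"
    and U :: "real^3 \<Rightarrow> real^3 \<Rightarrow> real"
  assumes "L > 0" and "Kmax > 0" and "hbar > 0" and "m > 0" and "mu > 0"
    and "\<Lambda> = momenta L Kmax"
    and "distinct ks" and "set ks = \<Lambda>"
    and "\<And>k. \<xi> k = hbar ^ 2 * norm k ^ 2 / (2 * m) - mu"
    and "\<And>k k'. k \<in> \<Lambda> \<Longrightarrow> k' \<in> \<Lambda> \<Longrightarrow> U k k' \<le> 0"
    and "\<And>k k'. k \<in> \<Lambda> \<Longrightarrow> k' \<in> \<Lambda> \<Longrightarrow> U k' k = U k k'"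
    and "\<And>k k'. k \<in> \<Lambda> \<Longrightarrow> k' \<in> \<Lambda> \<Longrightarrow> U (- k) (- k') = U k k'"
    and "\<And>k. k \<in> \<Lambda> \<Longrightarrow> U k k = 0"
    and "\<And>k. k \<in> \<Lambda> \<Longrightarrow> \<Delta> k \<ge> 0"
    and "\<And>k. k \<in> \<Lambda> \<Longrightarrow> \<Delta> (- k) = \<Delta> k"
    and "\<And>k. k \<in> \<Lambda> \<Longrightarrow>
           \<Delta> k = - (1 / 2) * (\<Sum>k'\<in>\<Lambda>. U k k' * \<Delta> k' / sqrt (\<xi> k' ^ 2 + \<Delta> k' ^ 2))"
    and "\<And>k. k \<in> \<Lambda> \<Longrightarrow> \<theta> k \<in> {0..pi / 2}"
    and "\<And>k. k \<in> \<Lambda> \<Longrightarrow>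
           if (\<forall>k'\<in>\<Lambda>. \<Delta> k' = 0) \<and> \<xi> k = 0 then \<theta> k = pi / 2
           else sin (2 * \<theta> k) = \<Delta> k / sqrt (\<xi> k ^ 2 + \<Delta> k ^ 2) \<and>
                cos (2 * \<theta> k) = \<xi> k / sqrt (\<xi> k ^ 2 + \<Delta> k ^ 2)"
  shows "braket ks (BCS_state ks \<theta>) (BCS_Hamiltonian ks \<xi> U (BCS_state ks \<theta>))
           - braket ks (Fermi_vacuum ks \<xi>) (BCS_Hamiltonian ks \<xi> U (Fermi_vacuum ks \<xi>))
         = complex_of_real (- (1 / 2) * (\<Sum>k\<in>\<Lambda>.
             (sqrt (\<xi> k ^ 2 + \<Delta> k ^ 2) - \<bar>\<xi> k\<bar>) ^ 2 / sqrt (\<xi> k ^ 2 + \<Delta> k ^ 2)))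
       \<and> ((\<exists>k\<in>\<Lambda>. \<Delta> k \<noteq> 0) \<longrightarrow>
           - (1 / 2) * (\<Sum>k\<in>\<Lambda>.
             (sqrt (\<xi> k ^ 2 + \<Delta> k ^ 2) - \<bar>\<xi> k\<bar>) ^ 2 / sqrt (\<xi> k ^ 2 + \<Delta> k ^ 2)) < 0)"
proof -
  interpret momentum_list ks
    using assms(6-8) uminus_momenta by unfold_locales auto
  define E where "E k = sqrt (\<xi> k ^ 2 + \<Delta> k ^ 2)" for k
  have E_sq: "E k ^ 2 = \<xi> k ^ 2 + \<Delta> k ^ 2" for k by (simp add: E_def)
  have \<xi>_even: "\<xi> (- k) = \<xi> k" for k by (simp add: assms(9))
  \<comment> \<open>The lattice and \<open>\<xi>\<close> are symmetric under negation, so the Down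
    modes contribute as much as the Up modes.\<close>
  have fold_even: "(\<Sum>k\<in>set ks. \<xi> k * (g k + g (- k))) = (\<Sum>k\<in>set ks. 2 * \<xi> k * g k)" for g
  proof -
    have "(\<Sum>k\<in>set ks. \<xi> k * g (- k)) = (\<Sum>k\<in>set ks. \<xi> k * g k)"
      using uminus_ks \<xi>_even by (intro sum.reindex_bij_witness[of _ uminus uminus]) auto
    then show ?thesis by (simp add: distrib_left sum.distrib mult.assoc flip: sum_distrib_left)
  qed
  \<comment> \<open>The factor \<open>\<xi> k\<close> makes the cosine formula cover the exceptional
    angle \<open>pi / 2\<close> as well: there both numerators vanish, and 0 divided by 0 is
    0.\<close>
  have trig: "sin (2 * \<theta> k) = \<Delta> k / E k" "\<xi> k * cos (2 * \<theta> k) = \<xi> k ^ 2 / E k"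
    if k: "k \<in> set ks" for k
  proof -
    have "sin (2 * \<theta> k) = \<Delta> k / E k \<and> \<xi> k * cos (2 * \<theta> k) = \<xi> k ^ 2 / E k"
    proof (cases "(\<forall>k'\<in>\<Lambda>. \<Delta> k' = 0) \<and> \<xi> k = 0")
      case True
      then have "2 * \<theta> k = pi" using assms(18)[of k] k assms(8) by simp
      then show ?thesis using True k assms(8) by simp
    next
      case False
      then show ?thesis using assms(18)[of k] k assms(8) by (simp add: E_def power2_eq_square)
    qed
    then show "sin (2 * \<theta> k) = \<Delta> k / E k" "\<xi> k * cos (2 * \<theta> k) = \<xi> k ^ 2 / E k"
      by simp_all
  qed
  have cos_sin: "cos (\<theta> k) * sin (\<theta> k) = \<Delta> k / (2 * E k)" if "k \<in> set ks" for k
  proof -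
    have "cos (\<theta> k) * sin (\<theta> k) = sin (2 * \<theta> k) / 2" by (simp add: sin_double)
    then show ?thesis by (simp add: trig(1)[OF that])
  qed
  have kinetic: "2 * \<xi> k * sin (\<theta> k) ^ 2 = \<xi> k - \<xi> k ^ 2 / E k" if "k \<in> set ks" for k
  proof -
    have "2 * \<xi> k * sin (\<theta> k) ^ 2 = \<xi> k - \<xi> k * cos (2 * \<theta> k)"
      by (simp add: cos_double_sin right_diff_distrib)
    then show ?thesis by (simp add: trig(2)[OF that])
  qed
  have gap: "(\<Sum>k'\<in>set ks. U k k' * (\<Delta> k' / (2 * E k'))) = - \<Delta> k" if "k \<in> set ks" for k
    using assms(16)[of k] that assms(8) by (simp add: E_def sum_distrib_left field_simps sum_negf)
  \<comment> \<open>The gap equation evaluates the inner sum, so the double sum over the couplings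
    collapses to a single sum over \<open>k\<close>.\<close>
  have pairing: "(\<Sum>k\<in>set ks. \<Sum>k'\<in>set ks. U k k' *
      (cos (\<theta> k) * sin (\<theta> k) * (cos (\<theta> k') * sin (\<theta> k')))) = (\<Sum>k\<in>set ks. - (\<Delta> k ^ 2 / (2 * E k)))"
  proof (intro sum.cong refl)
    fix k assume k: "k \<in> set ks"
    have "(\<Sum>k'\<in>set ks. U k k' * (cos (\<theta> k) * sin (\<theta> k) * (cos (\<theta> k') * sin (\<theta> k'))))
        = \<Delta> k / (2 * E k) * (\<Sum>k'\<in>set ks. U k k' * (\<Delta> k' / (2 * E k')))"
      unfolding sum_distrib_left cos_sin[OF k]
      by (intro sum.cong refl) (simp only: cos_sin mult.left_commute)
    then show "(\<Sum>k'\<in>set ks. U k k' * (cos (\<theta> k) * sin (\<theta> k) * (cos (\<theta> k') * sin (\<theta> k'))))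
        = - (\<Delta> k ^ 2 / (2 * E k))"
      unfolding gap[OF k] by (simp add: power2_eq_square)
  qed
  have BCS: "braket ks (BCS_state ks \<theta>) (BCS_Hamiltonian ks \<xi> U (BCS_state ks \<theta>))
      = of_real (\<Sum>k\<in>set ks. \<xi> k - \<xi> k ^ 2 / E k - \<Delta> k ^ 2 / (2 * E k))"
  proof -
    have "(\<Sum>k\<in>set ks. \<xi> k * (sin (\<theta> k) ^ 2 + sin (\<theta> (- k)) ^ 2))
        = (\<Sum>k\<in>set ks. \<xi> k - \<xi> k ^ 2 / E k)"
      unfolding fold_even[of "\<lambda>k. sin (\<theta> k) ^ 2"] by (intro sum.cong refl kinetic)
    moreover have "braket ks (BCS_state ks \<theta>) (BCS_Hamiltonian ks \<xi> U (BCS_state ks \<theta>)) =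
      of_real ((\<Sum>k\<in>set ks. \<xi> k * (sin (\<theta> k) ^ 2 + sin (\<theta> (- k)) ^ 2)) +
        (\<Sum>k\<in>set ks. \<Sum>k'\<in>set ks. U k k' *
          (cos (\<theta> k) * sin (\<theta> k) * (cos (\<theta> k') * sin (\<theta> k')))))"
      unfolding BCS_state_pair_vec by (rule pair_amp_energy) (simp_all add: assms(8,13))
    ultimately show ?thesis
      unfolding pairing by (simp add: sum_subtractf sum_negf)
  qed
  have Fermi: "braket ks (Fermi_vacuum ks \<xi>) (BCS_Hamiltonian ks \<xi> U (Fermi_vacuum ks \<xi>))
      = of_real (\<Sum>k\<in>set ks. \<xi> k - \<bar>\<xi> k\<bar>)"
  proof -
    \<comment> \<open>Sharp occupation up to the Fermi surface: \<open>u k * v k\<close> is always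
      0, so the interaction energy of this product state vanishes.\<close>
    define v :: "real^3 \<Rightarrow> real" where "v k = of_bool (k \<in> {k \<in> set ks. \<xi> k \<le> 0})" for k
    define u :: "real^3 \<Rightarrow> real" where "u k = of_bool (k \<notin> {k \<in> set ks. \<xi> k \<le> 0})" for k
    have state: "Fermi_vacuum ks \<xi> = pair_vec ks (\<lambda>S. of_real (pair_amp ks u v S))"
      unfolding Fermi_vacuum_pair_vec u_def v_def
      by (intro pair_vec_cong) (subst pair_amp_indicator, auto)
    have uv: "u k * v k = 0" for k by (simp add: u_def v_def)
    have "braket ks (Fermi_vacuum ks \<xi>) (BCS_Hamiltonian ks \<xi> U (Fermi_vacuum ks \<xi>)) =
      of_real ((\<Sum>k\<in>set ks. \<xi> k * (v k ^ 2 + v (- k) ^ 2)) +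
        (\<Sum>k\<in>set ks. \<Sum>k'\<in>set ks. U k k' * (u k * v k * (u k' * v k'))))"
      unfolding state by (rule pair_amp_energy) (simp_all add: assms(8,13) u_def v_def)
    \<comment> \<open>A momentum contributes \<open>2 * \<xi> k\<close> if
      \<open>\<xi> k \<le> 0\<close> and 0 otherwise, which is
      \<open>\<xi> k - \<bar>\<xi> k\<bar>\<close> in both cases.\<close>
    also have "(\<Sum>k\<in>set ks. \<xi> k * (v k ^ 2 + v (- k) ^ 2)) = (\<Sum>k\<in>set ks. \<xi> k - \<bar>\<xi> k\<bar>)"
      unfolding fold_even[of "\<lambda>k. v k ^ 2"] by (intro sum.cong) (auto simp: v_def)
    finally show ?thesis by (simp add: uv)
  qed
  have summand: "\<xi> k - \<xi> k ^ 2 / E k - \<Delta> k ^ 2 / (2 * E k) - (\<xi> k - \<bar>\<xi> k\<bar>)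
      = - (1 / 2) * ((E k - \<bar>\<xi> k\<bar>) ^ 2 / E k)" for k
  proof (cases "E k = 0")
    \<comment> \<open>Here \<open>\<xi> k\<close> vanishes too, and the quotients by
      \<open>E k\<close> are 0 by the convention for division by zero.\<close>
    case True
    then have "\<xi> k = 0" using E_sq[of k] by (simp add: sum_power2_eq_zero_iff)
    then show ?thesis using True by simp
  next
    case False
    have square: "(E k - \<bar>\<xi> k\<bar>) ^ 2 = 2 * \<xi> k ^ 2 + \<Delta> k ^ 2 - 2 * E k * \<bar>\<xi> k\<bar>"
      by (simp add: power2_diff E_sq)
    show ?thesis unfolding square using False by (simp add: field_simps)
  qed
  have "braket ks (BCS_state ks \<theta>) (BCS_Hamiltonian ks \<xi> U (BCS_state ks \<theta>))
      - braket ks (Fermi_vacuum ks \<xi>) (BCS_Hamiltonian ks \<xi> U (Fermi_vacuum ks \<xi>))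
    = of_real (- (1 / 2) * (\<Sum>k\<in>\<Lambda>. (E k - \<bar>\<xi> k\<bar>) ^ 2 / E k))"
    unfolding BCS Fermi of_real_diff[symmetric] sum_subtractf[symmetric] summand
      sum_distrib_left[symmetric] assms(8) ..
  \<comment> \<open>If all gaps vanish, then \<open>E k\<close> equals
    \<open>\<bar>\<xi> k\<bar>\<close> throughout and the sum is 0. One nonzero gap makes its
    summand positive, and the others are nonnegative.\<close>
  moreover have "- (1 / 2) * (\<Sum>k\<in>\<Lambda>. (E k - \<bar>\<xi> k\<bar>) ^ 2 / E k) < 0"
    if k: "k \<in> \<Lambda>" "\<Delta> k \<noteq> 0" for k
  proof -
    have nonneg: "E k \<ge> 0" for k by (simp add: E_def)
    have "E k ^ 2 > \<bar>\<xi> k\<bar> ^ 2" using k(2) by (simp add: E_sq)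
    then have "E k > \<bar>\<xi> k\<bar>" using nonneg power2_less_imp_less by blast
    then have "(E k - \<bar>\<xi> k\<bar>) ^ 2 / E k > 0" by (intro divide_pos_pos) auto
    then have "(\<Sum>k\<in>\<Lambda>. (E k - \<bar>\<xi> k\<bar>) ^ 2 / E k) > 0"
      using k(1) assms(8) nonneg by (intro sum_pos2[of _ k]) auto
    then show ?thesis by simp
  qed
  ultimately show ?thesis unfolding E_def by blast
qed

end
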